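(* For every $n\in\mathbb N$ and every $2$-colouring of the edges of the complete $3$-uniform hypergraph $\mathcal K^{(3)}_n$ on $n$ vertices, there are two vertex-disjoint monochromatic tight paths, of different colours, that together cover all the vertices of $\mathcal K^{(3)}_n$.
   Context: The edges of $\mathcal K^{(3)}_n$ are all $3$-element subsets of an $n$-element vertex set; a $2$-colouring assigns each edge one of two colours (say red and blue). A tight path in a $3$-uniform hypergraph is an ordered sequence of distinct vertices such that every three consecutive vertices of the sequence form an edge. A tight path may be empty (no vertices), and sequences of one or two vertices also count as tight paths (this is only needed for $n\le 5$). A tight path is monochromatic in a given colour if all of its edges (the triples of consecutive vertices) have that colour; a tight path with no edges may be regarded as having either colour. So the conclusion asks for one tight path whose edges are all red and one, disjoint from it, whose edges are all blue. *)

theory Defs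
  imports Main "HOL-Library.Ramsey"
begin

text \<open>
  A 3-uniform hypergraph is given by a vertex set and a set of 3-element edges; the edge set of
  the complete one on \<open>V\<close> is \<open>[V]\<^bsup>3\<^esup>\<close>, written \<open>nsets V 3\<close> in the library.
\<close>

datatype colour = Red | Blue

definition path_edges :: "'a list \<Rightarrow> 'a set set" where
  "path_edges p = {{p ! i, p ! (i + 1), p ! (i + 2)} | i. i + 2 < length p}"

text \<open>Lists with fewer than three vertices have no edges and so are tight paths.\<close>

definition tight_path :: "'a set \<Rightarrow> 'a set set \<Rightarrow> 'a list \<Rightarrow> bool" where
  "tight_path V E p \<longleftrightarrow> distinct p \<and> set p \<subseteq> V \<and> path_edges p \<subseteq> E"

text \<open>
  A colouring is a total function on sets; only its values on the edges of the hypergraph matter.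
  A tight path without edges is monochromatic in both colours.
\<close>

definition monochromatic_path :: "('a set \<Rightarrow> colour) \<Rightarrow> colour \<Rightarrow> 'a list \<Rightarrow> bool" where
  "monochromatic_path c k p \<longleftrightarrow> (\<forall>e \<in> path_edges p. c e = k)"

end

theory Submission
  imports Defs "HOL-Library.Multiset"
begin

text \<open>
  We show more: the vertices can be ordered as \<open>u @ b # w\<close> with \<open>u @ [b]\<close> red and \<open>b # w\<close> blue,
  so that along a Hamiltonian sequence the colour switches at most once. A new vertex \<open>v\<close> is
  inserted as follows. The triple straddling \<open>b\<close> has some colour, so the two paths may be taken to
  share two vertices \<open>x, y\<close>; by symmetry \<open>xyv\<close> is red. Unless \<open>v\<close> fits directly behind \<open>y\<close>,
  the vertices \<open>v, y\<close> can be put in front of the rest of the blue path. If \<open>s\<close> and \<open>t\<close> are the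
  outer ends of the red and blue path, then \<open>svy\<close> may be assumed red and \<open>tvy\<close> blue, as
  otherwise one path can be reversed and linked to the other. Now either colour of \<open>stv\<close> allows
  moving one of \<open>s, t\<close> across and linking the two paths at the pair \<open>s, t\<close>.
\<close>

section \<open>Edges and colours of lists under extension, reversal and taking segments\<close>

lemma path_edges_short [simp]:
  "path_edges [] = {}" "path_edges [a] = {}" "path_edges [a, b] = {}"
  by (auto simp: path_edges_def)

lemma path_edges_Cons [simp]:
  "path_edges (a # b # d # xs) = insert {a, b, d} (path_edges (b # d # xs))"
proof (intro equalityI subsetI)
  fix e assume "e \<in> path_edges (a # b # d # xs)"
  then obtain i where i: "i + 2 < length (a # b # d # xs)"
    and e: "e = {(a # b # d # xs) ! i, (a # b # d # xs) ! (i + 1), (a # b # d # xs) ! (i + 2)}"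
    unfolding path_edges_def by blast
  show "e \<in> insert {a, b, d} (path_edges (b # d # xs))"
  proof (cases i)
    case 0
    then show ?thesis using e by simp
  next
    case (Suc j)
    then have "j + 2 < length (b # d # xs)"
      and "e = {(b # d # xs) ! j, (b # d # xs) ! (j + 1), (b # d # xs) ! (j + 2)}"
      using i e by simp_all
    then show ?thesis unfolding path_edges_def by blast
  qed
next
  fix e assume "e \<in> insert {a, b, d} (path_edges (b # d # xs))"
  then consider "e = {a, b, d}"
    | j where "j + 2 < length (b # d # xs)"
      "e = {(b # d # xs) ! j, (b # d # xs) ! (j + 1), (b # d # xs) ! (j + 2)}"
    unfolding path_edges_def by blast
  then show "e \<in> path_edges (a # b # d # xs)"
  proof cases
    case 1
    then show ?thesis unfolding path_edges_def by (intro CollectI exI[of _ 0]) simp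
  next
    case 2
    then show ?thesis unfolding path_edges_def by (intro CollectI exI[of _ "Suc j"]) simp
  qed
qed

lemma path_edges_rev_subset: "path_edges (rev xs) \<subseteq> path_edges xs"
proof
  fix e assume "e \<in> path_edges (rev xs)"
  then obtain i where i: "i + 2 < length xs"
    and e: "e = {rev xs ! i, rev xs ! (i + 1), rev xs ! (i + 2)}"
    unfolding path_edges_def by auto
  \<comment> \<open>Reversal turns the triple starting at \<open>i\<close> into the one of
    \<open>xs\<close> starting at \<open>j\<close>, read backwards.\<close>
  define j where "j = length xs - 3 - i"
  have "rev xs ! i = xs ! (j + 2)" "rev xs ! (i + 1) = xs ! (j + 1)" "rev xs ! (i + 2) = xs ! j"
    using i by (simp_all add: rev_nth j_def numeral_eq_Suc Suc_diff_Suc)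
  then have "e = {xs ! j, xs ! (j + 1), xs ! (j + 2)}" using e by auto
  moreover have "j + 2 < length xs" using i by (simp add: j_def)
  ultimately show "e \<in> path_edges xs" unfolding path_edges_def by blast
qed

lemma path_edges_rev [simp]: "path_edges (rev xs) = path_edges xs"
  using path_edges_rev_subset[of xs] path_edges_rev_subset[of "rev xs"] by auto

text \<open>Reversal carries the rule for \<open>#\<close> over to the far end of the list.\<close>

lemma path_edges_snoc [simp]:
  "path_edges (xs @ [a, b, d]) = insert {a, b, d} (path_edges (xs @ [a, b]))"
proof -
  have "path_edges (xs @ [a, b, d]) = path_edges (rev (xs @ [a, b, d]))"
    by (rule path_edges_rev[symmetric])
  also have "\<dots> = insert {a, b, d} (path_edges (rev (xs @ [a, b])))"
    by (auto simp: insert_commute)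
  finally show ?thesis by (simp only: path_edges_rev)
qed

lemma path_edges_append1: "path_edges xs \<subseteq> path_edges (xs @ ys)"
  by (fastforce simp: path_edges_def nth_append)

lemma path_edges_append2: "path_edges ys \<subseteq> path_edges (xs @ ys)"
  using path_edges_append1[of "rev ys" "rev xs"] path_edges_rev[of "xs @ ys"] by simp

text \<open>Distinctness keeps three consecutive entries from collapsing to a smaller set.\<close>

lemma path_edges_subset_nsets:
  assumes "distinct p" "set p \<subseteq> V"
  shows "path_edges p \<subseteq> nsets V 3"
proof
  fix e assume "e \<in> path_edges p"
  then obtain i where "i + 2 < length p" "e = {p ! i, p ! (i + 1), p ! (i + 2)}"
    unfolding path_edges_def by blast
  moreover from this have "p ! i \<noteq> p ! (i + 1)" "p ! i \<noteq> p ! (i + 2)" "p ! (i + 1) \<noteq> p ! (i + 2)"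
    using assms(1) by (simp_all add: nth_eq_iff_index_eq)
  ultimately show "e \<in> nsets V 3"
    using assms(2) nth_mem[of _ p] by (auto simp: nsets_def)
qed

lemma monochromatic_path_short [simp]:
  "monochromatic_path c k []" "monochromatic_path c k [a]" "monochromatic_path c k [a, b]"
  by (simp_all add: monochromatic_path_def)

lemma monochromatic_path_Cons [simp]:
  "monochromatic_path c k (a # b # d # xs) \<longleftrightarrow> c {a, b, d} = k \<and> monochromatic_path c k (b # d # xs)"
  by (simp add: monochromatic_path_def)

lemma monochromatic_path_snoc [simp]:
  "monochromatic_path c k (xs @ [a, b, d]) \<longleftrightarrow> c {a, b, d} = k \<and> monochromatic_path c k (xs @ [a, b])"
  by (simp add: monochromatic_path_def)

lemma monochromatic_path_rev: "monochromatic_path c k (rev xs) \<longleftrightarrow> monochromatic_path c k xs"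
  by (simp add: monochromatic_path_def)

lemma monochromatic_path_append1: "monochromatic_path c k (xs @ ys) \<Longrightarrow> monochromatic_path c k xs"
  using path_edges_append1[of xs ys] by (auto simp: monochromatic_path_def)

lemma monochromatic_path_append2: "monochromatic_path c k (xs @ ys) \<Longrightarrow> monochromatic_path c k ys"
  using path_edges_append2[of ys xs] by (auto simp: monochromatic_path_def)

section \<open>Lists with one colour switch\<close>

text \<open>The triple centred at the shared vertex \<open>b\<close> is not constrained.\<close>

definition one_switch :: "('a set \<Rightarrow> colour) \<Rightarrow> colour \<Rightarrow> colour \<Rightarrow> 'a list \<Rightarrow> bool" where
  "one_switch c k l xs \<longleftrightarrow>
    (\<exists>u b w. xs = u @ b # w \<and> monochromatic_path c k (u @ [b]) \<and> monochromatic_path c l (b # w))"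

lemma one_switchI:
  "monochromatic_path c k (u @ [b]) \<Longrightarrow> monochromatic_path c l (b # w) \<Longrightarrow> one_switch c k l (u @ b # w)"
  unfolding one_switch_def by blast

text \<open>Reading the list backwards exchanges the two paths. This is the symmetry that lets one
  fix the colour of a triple containing a new vertex.\<close>

lemma one_switch_rev: "one_switch c k l xs \<Longrightarrow> one_switch c l k (rev xs)"
proof -
  assume "one_switch c k l xs"
  then obtain u b w where xs: "xs = u @ b # w"
    and "monochromatic_path c k (u @ [b])" "monochromatic_path c l (b # w)"
    unfolding one_switch_def by blast
  then have "monochromatic_path c l (rev w @ [b])" "monochromatic_path c k (b # rev u)"
    using monochromatic_path_rev[of c k "u @ [b]"] monochromatic_path_rev[of c l "b # w"] by simp_all
  from one_switchI[OF this] show ?thesis by (simp add: xs)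
qed

text \<open>The triple centred at the shared vertex has one of the two colours, so the path of that
  colour extends across the switch by one vertex.\<close>

lemma one_switch_shared_pair:
  assumes "one_switch c k l xs" "k \<noteq> l" "length xs \<ge> 2"
  obtains p x y q where "xs = p @ x # y # q"
    "monochromatic_path c k (p @ [x, y])" "monochromatic_path c l (x # y # q)"
proof -
  obtain u b w where xs: "xs = u @ b # w"
    and u: "monochromatic_path c k (u @ [b])" and w: "monochromatic_path c l (b # w)"
    using assms(1) unfolding one_switch_def by blast
  show thesis
  proof (cases w)
    case Nil
    \<comment> \<open>The switch is at the last vertex: the final two vertices form the pair, and
      the second path has no edges.\<close>
    then obtain u' a where "u = u' @ [a]" using assms(3) xs by (cases u rule: rev_cases) auto
    then show thesis using that[of u' a b "[]"] u xs Nil by simp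
  next
    case w': (Cons d w')
    show thesis
    proof (cases u rule: rev_cases)
      case Nil
      then show thesis using that[of "[]" b d w'] w xs w' by simp
    next
      case (snoc u' a)
      have "c {a, b, d} = k \<or> c {a, b, d} = l" using assms(2) by (metis colour.exhaust)
      \<comment> \<open>Either the first path takes in \<open>d\<close>, with pair
        \<open>b, d\<close>, or the second takes in \<open>a\<close>, with pair
        \<open>a, b\<close>.\<close>
      then show thesis
        using that[of u b d w'] that[of u' a b w] u w xs w' snoc by auto
    qed
  qed
qed

section \<open>Inserting one vertex\<close>

lemma insert_vertex_aux:
  assumes k: "monochromatic_path c k (p @ [x, y])" and l: "monochromatic_path c l (x # y # q)"
    and kl: "k \<noteq> l" and xyv: "c {x, y, v} = k"
  shows "\<exists>ys. mset ys = add_mset v (mset (p @ x # y # q)) \<and> one_switch c k l ys"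
proof (cases q)
  case Nil
  have "one_switch c k l ((p @ [x, y]) @ v # [])"
    using k xyv by (intro one_switchI) simp_all
  then show ?thesis using Nil by (intro exI conjI) simp_all
next
  case (Cons z q')
  have other: "c e = l" if "c e \<noteq> k" for e using kl that by (metis colour.exhaust)
  have xyv_path: "monochromatic_path c k (p @ [x, y, v])" using k xyv by simp
  have yq: "monochromatic_path c l (y # q)" using monochromatic_path_append2[of c l "[x]"] l by simp
  have q: "monochromatic_path c l q" using monochromatic_path_append2[of c l "[x, y]"] l by simp
  have px: "monochromatic_path c k (p @ [x])" using monochromatic_path_append1[of c k "p @ [x]" "[y]"] k by simp
  have extend: "monochromatic_path c k (p @ [x, y, v, a])" if "c {y, v, a} = k" for a
    using monochromatic_path_snoc[of c k "p @ [x]" y v a] xyv_path that by simp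
  show ?thesis
  proof (cases "c {y, v, z} = k")
    case True
    \<comment> \<open>\<open>v\<close> joins the first path, and the switch moves on to
      \<open>z\<close>.\<close>
    then have "one_switch c k l ((p @ [x, y, v]) @ z # q')"
      using extend q Cons by (intro one_switchI) simp_all
    then show ?thesis using Cons by (intro exI conjI) simp_all
  next
    case False
    \<comment> \<open>Leaving \<open>x\<close> to the first path frees the place in front of
      \<open>y\<close> for \<open>v\<close>.\<close>
    then have vyq: "monochromatic_path c l (v # y # q)"
      using yq other[of "{v, y, z}"] Cons by (simp add: insert_commute)
    show ?thesis
    proof (cases p)
      case Nil
      have "one_switch c k l ([x] @ v # y # q)" using vyq by (intro one_switchI) simp_all
      then show ?thesis using Nil by (intro exI conjI) simp_all
    next
      case p: (Cons s p')
      \<comment> \<open>Reversed, the first path has its outer end \<open>s\<close> at the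
        switch.\<close>
      have p'x: "monochromatic_path c k (rev (p' @ [x]) @ [s])"
        using px p monochromatic_path_rev[of c k "p @ [x]"] by simp
      obtain q'' t where q'': "q = q'' @ [t]" using Cons by (metis list.distinct(1) rev_exhaust)
      have rq: "monochromatic_path c l (t # rev q'')"
        using q q'' monochromatic_path_rev[of c l q] by simp
      \<comment> \<open>If the first two alternatives fail, \<open>{s, v, y}\<close> has colour
        \<open>k\<close> and \<open>{t, v, y}\<close> colour \<open>l\<close>; the colour of
        \<open>{s, t, v}\<close> then selects one of the last two.\<close>
      consider "c {s, v, y} = l" | "c {y, v, t} = k"
        | "c {y, v, s} = k" "c {v, s, t} = k" | "c {s, t, v} = l" "c {t, v, y} = l"
        using other by (metis insert_commute)
      then show ?thesis
      proof cases
        case 1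
        then have "one_switch c k l (rev (p' @ [x]) @ s # v # y # q)"
          using p'x vyq by (intro one_switchI) simp_all
        then show ?thesis using p by (intro exI conjI) simp_all
      next
        case 2
        then have "one_switch c k l ((p @ [x, y, v]) @ t # rev q'')"
          using extend rq by (intro one_switchI) simp_all
        then show ?thesis using q'' by (intro exI conjI) simp_all
      next
        case 3
        \<comment> \<open>\<open>s\<close> moves from the front of the first path to behind
          \<open>v\<close>, and \<open>t\<close> becomes the shared vertex.\<close>
        have "monochromatic_path c k (p' @ [x, y, v, s])"
          using extend[OF 3(1)] monochromatic_path_append2[of c k "[s]" "p' @ [x, y, v, s]"] p by simp
        then have "monochromatic_path c k ((p' @ [x, y, v, s]) @ [t])"
          using 3(2) monochromatic_path_snoc[of c k "p' @ [x, y]" v s t] by simp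
        then have "one_switch c k l ((p' @ [x, y, v, s]) @ t # rev q'')"
          using rq by (intro one_switchI)
        then show ?thesis using p q'' by (intro exI conjI) simp_all
      next
        case 4
        \<comment> \<open>\<open>t\<close> moves from the end of the second path to before
          \<open>v\<close>, and \<open>s\<close> becomes the shared vertex.\<close>
        have "monochromatic_path c l (v # y # q'')"
          using monochromatic_path_append1[of c l "v # y # q''" "[t]"] vyq q'' by simp
        then have "one_switch c k l (rev (p' @ [x]) @ s # t # v # y # q'')"
          using p'x 4 by (intro one_switchI) simp_all
        then show ?thesis using p q'' by (intro exI conjI) simp_all
      qed
    qed
  qed
qed

lemma insert_vertex:
  assumes "one_switch c k l xs" "k \<noteq> l"
  shows "\<exists>ys. mset ys = add_mset v (mset xs) \<and> one_switch c k l ys"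
proof (cases "length xs \<ge> 2")
  case True
  obtain p x y q where xs: "xs = p @ x # y # q"
    and k: "monochromatic_path c k (p @ [x, y])" and l: "monochromatic_path c l (x # y # q)"
    using one_switch_shared_pair[OF assms True] .
  show ?thesis
  proof (cases "c {x, y, v} = k")
    case True
    then show ?thesis using insert_vertex_aux[OF k l assms(2)] xs by simp
  next
    case False
    then have "c {y, x, v} = l" using assms(2) by (metis colour.exhaust insert_commute)
    moreover have "monochromatic_path c l (rev q @ [y, x])" "monochromatic_path c k (y # x # rev p)"
      using k l monochromatic_path_rev[of c k "p @ [x, y]"] monochromatic_path_rev[of c l "x # y # q"]
      by simp_all
    \<comment> \<open>The mirror image: the list is reversed, the colours are swapped, and the pair
      reads \<open>y, x\<close>.\<close>
    ultimately obtain ys where "mset ys = add_mset v (mset (rev q @ y # x # rev p))" "one_switch c l k ys"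
      using insert_vertex_aux assms(2) by metis
    then show ?thesis
      using one_switch_rev[of c l k ys] xs by (intro exI[of _ "rev ys"]) simp
  qed
next
  case False
  moreover have "xs \<noteq> []" using assms(1) by (auto simp: one_switch_def)
  ultimately obtain a where xs: "xs = [a]" by (cases xs) (auto simp: Suc_le_eq)
  have "one_switch c k l ([a] @ v # [])" by (intro one_switchI) simp_all
  then show ?thesis using xs by (intro exI conjI) simp_all
qed

section \<open>Induction on the vertex set and the two paths\<close>

lemma ex_one_switch:
  assumes "finite V" "V \<noteq> {}" "k \<noteq> l"
  shows "\<exists>xs. distinct xs \<and> set xs = V \<and> one_switch c k l xs"
  using assms(1,2)
proof (induction rule: finite_ne_induct)
  case (singleton x)
  have "one_switch c k l ([] @ x # [])" by (intro one_switchI) simp_all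
  then show ?case by (intro exI[of _ "[x]"]) simp
next
  case (insert v F)
  then obtain xs where xs: "distinct xs" "set xs = F" "one_switch c k l xs" by blast
  obtain ys where ys: "mset ys = mset (v # xs)" "one_switch c k l ys"
    using insert_vertex[OF xs(3) assms(3)] by auto
  \<comment> \<open>The multiset equation makes \<open>ys\<close> a rearrangement of
    \<open>v # xs\<close>, which is distinct since \<open>v\<close> is new.\<close>
  then have "distinct ys" "set ys = insert v F"
    using xs insert.hyps mset_eq_imp_distinct_iff[OF ys(1)] mset_eq_setD[OF ys(1)] by auto
  then show ?case using ys(2) by blast
qed

theorem theorem1:
  fixes n :: nat and V :: "'a set" and c :: "'a set \<Rightarrow> colour"
  assumes "finite V" and "card V = n"
  shows "\<exists>p q. tight_path V (nsets V 3) p \<and> monochromatic_path c Red p \<and>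
               tight_path V (nsets V 3) q \<and> monochromatic_path c Blue q \<and>
               set p \<inter> set q = {} \<and> set p \<union> set q = V"
proof (cases "V = {}")
  case True
  then show ?thesis by (intro exI[of _ "[]"]) (simp add: tight_path_def)
next
  case False
  then obtain xs where xs: "distinct xs" "set xs = V" "one_switch c Red Blue xs"
    using ex_one_switch[OF assms(1)] by blast
  then obtain u b w where ubw: "xs = u @ b # w"
    "monochromatic_path c Red (u @ [b])" "monochromatic_path c Blue (b # w)"
    unfolding one_switch_def by blast
  \<comment> \<open>Giving the shared vertex \<open>b\<close> to the red path makes the paths
    disjoint; the blue one just loses its first vertex.\<close>
  have "tight_path V (nsets V 3) (u @ [b])" "tight_path V (nsets V 3) w"
    unfolding tight_path_def using xs ubw(1) by (intro conjI path_edges_subset_nsets; auto)+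
  moreover have "monochromatic_path c Blue w"
    using monochromatic_path_append2[of c Blue "[b]" w] ubw(3) by simp
  moreover have "set (u @ [b]) \<inter> set w = {}" "set (u @ [b]) \<union> set w = V"
    using xs ubw(1) by auto
  ultimately show ?thesis using ubw(2) by blast
qed

end
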